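(* When the lateral collision constraint $p_i(t_c^f)\le L$ is active at the interior point $t_i^m=t_c^f$ (that is, $p_i(t_c^f)=L$), the optimal control of CAV $i$ is continuous there, i.e. $u_i^*(t_i^{m-})=u_i^*(t_i^{m+})$.
   Context: Setting. Connected automated vehicles (CAVs) cross a signal-free intersection in a fixed first-in-first-out order, with no overtaking, reversing, lane changing or turns. Each CAV $i$ travels a control zone of length $L$ followed by a merging zone of length $S<L$. It enters the control zone at time $t_i^0$, enters the merging zone at time $t_i^m$ (so $p_i(t_i^m)=L$), and exits the merging zone at time $t_i^f$. The superscripts in $t_i^{m-}$ and $t_i^{m+}$ denote left and right limits at $t_i^m$. Problem of CAV $i$. Position $p_i$, speed $v_i$ and control (acceleration) $u_i$ satisfy $\dot p_i=v_i$, $\dot v_i=u_i$, $p_i(t_i^0)=0$, $v_i(t_i^0)=v_i^0$ given, and $p_i(t_i^f)=L+S$. CAV $i$ minimizes $\int_{t_i^0}^{t_i^f}[\gamma+\tfrac12u_i^2(t)]\,dt$, where $\gamma$ is a normalized weight expressing the importance of travel time relative to energy, and where $t_i^f$ may be free or constrained. The optimal control is denoted $u_i^*$. The constraints are: - $u_{\min}\le u_i(t)\le u_{\max}$ and $0\le v_{\min}\le v_i(t)\le v_{\max}$ on $[t_i^0,t_i^f]$; - the rear-end safety constraint $p_k(t)-p_i(t)\ge\varphi v_i(t)+\delta_0$ on $[t_i^0,t_i^f]$, where $k$ is the CAV immediately ahead of $i$ on the same lane, $\varphi$ is the reaction time and $\delta_0$ is the minimal standstill distance (CAV $k$ keeps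 constant speed after exiting the merging zone); - the lateral collision constraint $p_i(t_c^f)\le L$ (equivalently $t_i^m\ge t_c^f$), where $c$ is the last CAV preceding $i$ in the crossing order that travels on a different road and could collide with $i$ in the merging zone, and $t_c^f$, the time at which $c$ exits the merging zone, is known to $i$; - $\max\{t_i^L,\;t_k^f+(\varphi v_i^f+\delta_0)/v_k^f,\;t_o^f\}\le t_i^f\le t_i^U$, where $v_j^f=v_j(t_j^f)$ for a CAV $j$, $o$ is the last CAV preceding $i$ among those on the same road as $i$ in a different lane or in the opposite direction (which cannot collide with $i$), and $t_i^L$, $t_i^U$ are the lower and upper bounds on $t_i^f$ determined by the speed and control limits alone. The speed constraints and the rear-end constraint are assumed not to be active at $t_i^0$. Optimality conditions. The Hamiltonian is $H_i=\gamma+\tfrac12u_i^2+\lambda_i^pv_i+\lambda_i^vu_i$, with costates $\lambda_i^p,\lambda_i^v$. The stationarity condition is: $u_i+\lambda_i^v=0$ when $u_{\min}<u_i<u_{\max}$; $u_i+\lambda_i^v+\mu_i^a=0$ when $u_i=u_{\max}$; $u_i+\lambda_i^v-\mu_i^b=0$ when $u_i=u_{\min}$, with multipliers $\mu_i^a,\mu_i^b\ge0$. At the interior point $t_c^f$ where the lateral constraint is active, with $N_i=p_i-L$ and a constant multiplier $\pi_i\ge0$, the jump conditions are $$\lambda_i^p(t_c^{f-})=\lambda_i^p(t_c^{f+})+\pi_i\frac{\partial N_i}{\partial p_i},\quad \lambda_i^v(t_c^{f-})=\lambda_i^v(t_c^{f+})+\pi_i\frac{\partial N_i}{\partial v_i},\quad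 H_i(t_c^{f-})=H_i(t_c^{f+})-\pi_i\frac{\partial N_i}{\partial t}.$$ *)

theory Defs
  imports "HOL-Analysis.Analysis" "HOL-Library.Extended_Real"
begin

text \<open>
  CAVs are numbered by their position in the crossing order.
\<close>

definition piecewise_continuous_on :: "real \<Rightarrow> real \<Rightarrow> (real \<Rightarrow> real) \<Rightarrow> bool" where
  "piecewise_continuous_on a b f \<longleftrightarrow>
     (\<exists>D. finite D \<and> continuous_on ({a..b} - D) f) \<and>
     (\<forall>t\<in>{a<..b}. \<exists>l. (f \<longlongrightarrow> l) (at_left t)) \<and>
     (\<forall>t\<in>{a..<b}. \<exists>l. (f \<longlongrightarrow> l) (at_right t))"

abbreviation left_lim :: "(real \<Rightarrow> real) \<Rightarrow> real \<Rightarrow> real" where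
  "left_lim f t \<equiv> Lim (at_left t) f"

abbreviation right_lim :: "(real \<Rightarrow> real) \<Rightarrow> real \<Rightarrow> real" where
  "right_lim f t \<equiv> Lim (at_right t) f"

record motion =
  pos :: "real \<Rightarrow> real"
  speed :: "real \<Rightarrow> real"
  accel :: "real \<Rightarrow> real"
  t_merge :: real
  t_exit :: real

text \<open>
  A lane has one direction of travel, so opposite directions of one road are different lanes.
  The set \<open>exit_times X i\<close> carries an extra restriction on the exit time of CAV \<open>i\<close>:
  \<open>UNIV\<close> when this time is free, a singleton when it is specified.
\<close>

record ('lane, 'road) scenario =
  len_control :: real
  len_merging :: real
  u_min :: real
  u_max :: real
  v_min :: real
  v_max :: real
  reaction :: real
  standstill :: real
  time_weight :: real
  lane :: "nat \<Rightarrow> 'lane"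
  road :: "nat \<Rightarrow> 'road"
  could_collide :: "nat \<Rightarrow> nat \<Rightarrow> bool"
  t_entry :: "nat \<Rightarrow> real"
  v_entry :: "nat \<Rightarrow> real"
  exit_times :: "nat \<Rightarrow> real set"
  cav :: "nat \<Rightarrow> motion"

definition last_preceding :: "nat \<Rightarrow> (nat \<Rightarrow> bool) \<Rightarrow> nat \<Rightarrow> bool" where
  "last_preceding i P j \<longleftrightarrow> j < i \<and> P j \<and> (\<forall>l. j < l \<and> l < i \<longrightarrow> \<not> P l)"

text \<open>
  Each of the following three vehicles may be absent, in which case the constraints that refer
  to it are void. They are the vehicles \<open>k\<close>, \<open>c\<close> and \<open>o\<close> of the problem of CAV \<open>i\<close>.
\<close>

definition leader :: "('lane, 'road) scenario \<Rightarrow> nat \<Rightarrow> nat \<Rightarrow> bool" where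
  "leader X i k \<longleftrightarrow> last_preceding i (\<lambda>j. road X j = road X i \<and> lane X j = lane X i) k"

definition lateral_predecessor :: "('lane, 'road) scenario \<Rightarrow> nat \<Rightarrow> nat \<Rightarrow> bool" where
  "lateral_predecessor X i c \<longleftrightarrow>
     last_preceding i (\<lambda>j. road X j \<noteq> road X i \<and> could_collide X j i) c"

definition parallel_predecessor :: "('lane, 'road) scenario \<Rightarrow> nat \<Rightarrow> nat \<Rightarrow> bool" where
  "parallel_predecessor X i o' \<longleftrightarrow>
     last_preceding i (\<lambda>j. road X j = road X i \<and> lane X j \<noteq> lane X i) o'"

definition obeys_dynamics :: "('lane, 'road) scenario \<Rightarrow> nat \<Rightarrow> motion \<Rightarrow> bool" where
  "obeys_dynamics X i y \<longleftrightarrow>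
     (let I = {t_entry X i..t_exit y} in
        t_entry X i \<le> t_merge y \<and> t_merge y \<le> t_exit y \<and>
        piecewise_continuous_on (t_entry X i) (t_exit y) (accel y) \<and>
        (\<forall>t\<in>I. (pos y has_real_derivative speed y t) (at t within I)) \<and>
        continuous_on I (speed y) \<and>
        (\<exists>D. finite D \<and>
          (\<forall>t\<in>I - D. (speed y has_real_derivative accel y t) (at t within I))) \<and>
        pos y (t_entry X i) = 0 \<and>
        speed y (t_entry X i) = v_entry X i \<and>
        pos y (t_merge y) = len_control X \<and>
        pos y (t_exit y) = len_control X + len_merging X)"

definition obeys_limits :: "('lane, 'road) scenario \<Rightarrow> nat \<Rightarrow> motion \<Rightarrow> bool" where
  "obeys_limits X i y \<longleftrightarrow>
     (\<forall>t\<in>{t_entry X i..t_exit y}.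
        u_min X \<le> accel y t \<and> accel y t \<le> u_max X \<and>
        v_min X \<le> speed y t \<and> speed y t \<le> v_max X)"

definition rear_end_safe :: "('lane, 'road) scenario \<Rightarrow> nat \<Rightarrow> motion \<Rightarrow> bool" where
  "rear_end_safe X i y \<longleftrightarrow>
     (\<forall>k. leader X i k \<longrightarrow>
        (\<forall>t\<in>{t_entry X i..t_exit y}.
           pos (cav X k) t - pos y t \<ge> reaction X * speed y t + standstill X))"

text \<open>
  The position of CAV \<open>i\<close> is only constrained between its entry and exit times. If \<open>c\<close> has left
  before \<open>i\<close> enters, there is nothing to require; if \<open>c\<close> left after the exit of \<open>i\<close>, the
  lateral constraint would be violated.
\<close>

definition laterally_safe :: "('lane, 'road) scenario \<Rightarrow> nat \<Rightarrow> motion \<Rightarrow> bool" where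
  "laterally_safe X i y \<longleftrightarrow>
     (\<forall>c. lateral_predecessor X i c \<and> t_entry X i \<le> t_exit (cav X c) \<longrightarrow>
        t_exit (cav X c) \<le> t_exit y \<and> pos y (t_exit (cav X c)) \<le> len_control X)"

definition reachable_exit_times :: "('lane, 'road) scenario \<Rightarrow> nat \<Rightarrow> real set" where
  "reachable_exit_times X i = t_exit ` {y. obeys_dynamics X i y \<and> obeys_limits X i y}"

text \<open>The upper bound can be infinite when the vehicle may stand still (\<open>v_min X = 0\<close>).\<close>

definition t_lower :: "('lane, 'road) scenario \<Rightarrow> nat \<Rightarrow> ereal" where
  "t_lower X i = Inf (ereal ` reachable_exit_times X i)"

definition t_upper :: "('lane, 'road) scenario \<Rightarrow> nat \<Rightarrow> ereal" where
  "t_upper X i = Sup (ereal ` reachable_exit_times X i)"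

definition exit_time_admissible :: "('lane, 'road) scenario \<Rightarrow> nat \<Rightarrow> motion \<Rightarrow> bool" where
  "exit_time_admissible X i y \<longleftrightarrow>
     t_exit y \<in> exit_times X i \<and>
     t_lower X i \<le> ereal (t_exit y) \<and>
     (\<forall>k. leader X i k \<longrightarrow>
        t_exit (cav X k) + (reaction X * speed y (t_exit y) + standstill X)
          / speed (cav X k) (t_exit (cav X k)) \<le> t_exit y) \<and>
     (\<forall>o'. parallel_predecessor X i o' \<longrightarrow> t_exit (cav X o') \<le> t_exit y) \<and>
     ereal (t_exit y) \<le> t_upper X i"

definition feasible :: "('lane, 'road) scenario \<Rightarrow> nat \<Rightarrow> motion \<Rightarrow> bool" where
  "feasible X i y \<longleftrightarrow>
     obeys_dynamics X i y \<and> obeys_limits X i y \<and> rear_end_safe X i y \<and>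
     laterally_safe X i y \<and> exit_time_admissible X i y"

definition cost :: "('lane, 'road) scenario \<Rightarrow> nat \<Rightarrow> motion \<Rightarrow> real" where
  "cost X i y =
     integral {t_entry X i..t_exit y} (\<lambda>t. time_weight X + (accel y t)\<^sup>2 / 2)"

definition optimal :: "('lane, 'road) scenario \<Rightarrow> nat \<Rightarrow> motion \<Rightarrow> bool" where
  "optimal X i y \<longleftrightarrow> feasible X i y \<and> (\<forall>z. feasible X i z \<longrightarrow> cost X i y \<le> cost X i z)"

text \<open>
  Standing assumptions for the problem of CAV \<open>i\<close>. The exit speed of the leader has to be
  positive because the bound on the exit time of \<open>i\<close> divides by it.
\<close>

definition standing_assumptions :: "('lane, 'road) scenario \<Rightarrow> nat \<Rightarrow> bool" where
  "standing_assumptions X i \<longleftrightarrow>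
     0 < len_merging X \<and> len_merging X < len_control X \<and> 0 \<le> v_min X \<and>
     (\<forall>j l. j \<le> l \<and> l \<le> i \<longrightarrow> t_entry X j \<le> t_entry X l) \<and>
     (\<forall>j<i. feasible X j (cav X j)) \<and>
     (\<forall>k. leader X i k \<longrightarrow>
        0 < speed (cav X k) (t_exit (cav X k)) \<and>
        (\<forall>t\<ge>t_exit (cav X k).
           speed (cav X k) t = speed (cav X k) (t_exit (cav X k)) \<and>
           pos (cav X k) t = pos (cav X k) (t_exit (cav X k)) +
             speed (cav X k) (t_exit (cav X k)) * (t - t_exit (cav X k)))) \<and>
     v_min X < v_entry X i \<and> v_entry X i < v_max X \<and>
     (\<forall>k. leader X i k \<longrightarrow>
        pos (cav X k) (t_entry X i) > reaction X * v_entry X i + standstill X)"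

definition hamiltonian ::
  "('lane, 'road) scenario \<Rightarrow> motion \<Rightarrow> (real \<Rightarrow> real) \<Rightarrow> (real \<Rightarrow> real) \<Rightarrow> real \<Rightarrow> real" where
  "hamiltonian X y lam_p lam_v t =
     time_weight X + (accel y t)\<^sup>2 / 2 + lam_p t * speed y t + lam_v t * accel y t"

text \<open>Stationarity may fail at finitely many times, where control or costates can jump.\<close>

definition stationarity ::
  "('lane, 'road) scenario \<Rightarrow> nat \<Rightarrow> motion \<Rightarrow> (real \<Rightarrow> real)
     \<Rightarrow> (real \<Rightarrow> real) \<Rightarrow> (real \<Rightarrow> real) \<Rightarrow> bool" where
  "stationarity X i y lam_v mu_a mu_b \<longleftrightarrow>
     (\<exists>D. finite D \<and> (\<forall>t\<in>{t_entry X i..t_exit y} - D.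
        0 \<le> mu_a t \<and> 0 \<le> mu_b t \<and>
        (u_min X < accel y t \<and> accel y t < u_max X \<longrightarrow> accel y t + lam_v t = 0) \<and>
        (accel y t = u_max X \<longrightarrow> accel y t + lam_v t + mu_a t = 0) \<and>
        (accel y t = u_min X \<longrightarrow> accel y t + lam_v t - mu_b t = 0)))"

definition lateral_N :: "('lane, 'road) scenario \<Rightarrow> real \<Rightarrow> real \<Rightarrow> real \<Rightarrow> real" where
  "lateral_N X p v t = p - len_control X"

definition jump_conditions ::
  "('lane, 'road) scenario \<Rightarrow> motion \<Rightarrow> real \<Rightarrow> (real \<Rightarrow> real) \<Rightarrow> (real \<Rightarrow> real)
     \<Rightarrow> real \<Rightarrow> bool" where
  "jump_conditions X y \<tau> lam_p lam_v \<pi> \<longleftrightarrow>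
     0 \<le> \<pi> \<and>
     left_lim lam_p \<tau> = right_lim lam_p \<tau>
       + \<pi> * deriv (\<lambda>p. lateral_N X p (speed y \<tau>) \<tau>) (pos y \<tau>) \<and>
     left_lim lam_v \<tau> = right_lim lam_v \<tau>
       + \<pi> * deriv (\<lambda>v. lateral_N X (pos y \<tau>) v \<tau>) (speed y \<tau>) \<and>
     left_lim (hamiltonian X y lam_p lam_v) \<tau> = right_lim (hamiltonian X y lam_p lam_v) \<tau>
       - \<pi> * deriv (\<lambda>t. lateral_N X (pos y \<tau>) (speed y \<tau>) t) \<tau>"

definition optimality_conditions ::
  "('lane, 'road) scenario \<Rightarrow> nat \<Rightarrow> motion \<Rightarrow> real \<Rightarrow> (real \<Rightarrow> real) \<Rightarrow> (real \<Rightarrow> real)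
     \<Rightarrow> (real \<Rightarrow> real) \<Rightarrow> (real \<Rightarrow> real) \<Rightarrow> real \<Rightarrow> bool" where
  "optimality_conditions X i y \<tau> lam_p lam_v mu_a mu_b \<pi> \<longleftrightarrow>
     piecewise_continuous_on (t_entry X i) (t_exit y) lam_p \<and>
     piecewise_continuous_on (t_entry X i) (t_exit y) lam_v \<and>
     stationarity X i y lam_v mu_a mu_b \<and>
     jump_conditions X y \<tau> lam_p lam_v \<pi>"

end

theory Submission
  imports Defs
begin

text \<open>
  The control is a continuous function of the speed costate, and the speed costate has no jump
  at the lateral contact point.

  By stationarity together with the control limits, the control equals the negated speed
  costate while it is interior; the signs of the multipliers say that at the upper limit the
  negated costate lies above that limit, and at the lower limit below it. In all cases the
  control is therefore the projection of the negated costate onto the interval of admissible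
  controls (\<open>optimal_control_is_projection\<close>). The function \<open>N\<close> of the lateral constraint does not
  depend on the speed, so the jump condition for the speed costate makes its one-sided limits
  agree (\<open>speed_costate_continuous_at_contact\<close>). Projection is continuous and passes this
  agreement on to the control. As the stationarity relations hold on both sides of the contact
  point whether or not a control limit is attained, the control may also switch between an
  interior and a saturated arc there.
\<close>

text \<open>
  The three cases of stationarity merge into one formula because a nonnegative multiplier only
  tells on which side of a control limit the negated costate lies, and this is all the projection
  depends on. A degenerate interval \<open>u_min X = u_max X\<close> is covered: it projects to one value.
\<close>

lemma optimal_control_is_projection:
  assumes "obeys_limits X i y" "stationarity X i y lam_v mu_a mu_b"
  obtains D where "finite D"
    "\<And>t. t \<in> {t_entry X i..t_exit y} - D \<Longrightarrow>
       accel y t = max (u_min X) (min (u_max X) (- lam_v t))"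
proof -
  obtain D where D: "finite D" and stat: "\<forall>t\<in>{t_entry X i..t_exit y} - D.
      0 \<le> mu_a t \<and> 0 \<le> mu_b t \<and>
      (u_min X < accel y t \<and> accel y t < u_max X \<longrightarrow> accel y t + lam_v t = 0) \<and>
      (accel y t = u_max X \<longrightarrow> accel y t + lam_v t + mu_a t = 0) \<and>
      (accel y t = u_min X \<longrightarrow> accel y t + lam_v t - mu_b t = 0)"
    using assms(2) unfolding stationarity_def by blast
  have "accel y t = max (u_min X) (min (u_max X) (- lam_v t))"
    if t: "t \<in> {t_entry X i..t_exit y} - D" for t
  proof -
    have lim: "u_min X \<le> accel y t" "accel y t \<le> u_max X"
      using assms(1) t unfolding obeys_limits_def by auto
    consider "u_min X < accel y t" "accel y t < u_max X"
      | "accel y t = u_max X" | "accel y t = u_min X"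
      using lim by linarith
    then show ?thesis
    proof cases
      case 1
      then have "accel y t = - lam_v t" using stat t by force
      then show ?thesis using lim by simp
    next
      case 2
      then have "accel y t \<le> - lam_v t" using stat t by force
      then show ?thesis using 2 lim by simp
    next
      case 3
      then have "- lam_v t \<le> accel y t" using stat t by force
      then show ?thesis using 3 lim by simp
    qed
  qed
  with D show thesis by (rule that)
qed

lemma speed_costate_continuous_at_contact:
  assumes "jump_conditions X y \<tau> lam_p lam_v \<pi>"
  shows "left_lim lam_v \<tau> = right_lim lam_v \<tau>"
  using assms unfolding jump_conditions_def lateral_N_def by simp

lemma piecewise_continuous_on_one_sided_limits:
  assumes "piecewise_continuous_on a b f" "a < t" "t < b"
  shows "(f \<longlongrightarrow> left_lim f t) (at_left t)" "(f \<longlongrightarrow> right_lim f t) (at_right t)"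
proof -
  obtain l r where "(f \<longlongrightarrow> l) (at_left t)" "(f \<longlongrightarrow> r) (at_right t)"
    using assms unfolding piecewise_continuous_on_def by force
  then show "(f \<longlongrightarrow> left_lim f t) (at_left t)" "(f \<longlongrightarrow> right_lim f t) (at_right t)"
    by (auto simp: tendsto_Lim)
qed

text \<open>
  Relations that fail only at finitely many times determine one-sided limits, because these times
  are avoided near any given point.
\<close>

lemma eventually_at_avoid_finite:
  fixes t :: real
  assumes "finite D" "a < t" "t < b"
  shows "\<forall>\<^sub>F s in at t. s \<in> {a..b} - D"
proof -
  have "open ({a<..<b} - (D - {t}))"
    using assms(1) by (intro open_Diff finite_imp_closed) auto
  then have "\<forall>\<^sub>F s in at t. s \<in> {a<..<b} - (D - {t}) \<and> s \<noteq> t"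
    using assms(2,3) by (auto simp: eventually_at_topological)
  then show ?thesis by eventually_elim auto
qed

theorem theorem3:
  fixes X :: "('lane, 'road) scenario" and i c :: nat
    and lam_p lam_v mu_a mu_b :: "real \<Rightarrow> real" and \<pi> :: real
  assumes "standing_assumptions X i"
    and "optimal X i (cav X i)"
    and "lateral_predecessor X i c"
    and "t_entry X i < t_exit (cav X c)" "t_exit (cav X c) < t_exit (cav X i)"
    and "t_merge (cav X i) = t_exit (cav X c)"
    and "pos (cav X i) (t_exit (cav X c)) = len_control X"
    and "optimality_conditions X i (cav X i) (t_exit (cav X c)) lam_p lam_v mu_a mu_b \<pi>"
  shows "\<exists>l. (accel (cav X i) \<longlongrightarrow> l) (at_left (t_merge (cav X i))) \<and>
             (accel (cav X i) \<longlongrightarrow> l) (at_right (t_merge (cav X i)))"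
proof -
  let ?y = "cav X i" and ?\<tau> = "t_exit (cav X c)"
  let ?proj = "\<lambda>x. max (u_min X) (min (u_max X) (- x))"
  have lims: "obeys_limits X i ?y"
    using assms(2) unfolding optimal_def feasible_def by blast
  have oc: "piecewise_continuous_on (t_entry X i) (t_exit ?y) lam_v"
      "stationarity X i ?y lam_v mu_a mu_b" "jump_conditions X ?y ?\<tau> lam_p lam_v \<pi>"
    using assms(8) unfolding optimality_conditions_def by auto
  obtain D where "finite D" and proj:
    "\<And>t. t \<in> {t_entry X i..t_exit ?y} - D \<Longrightarrow> accel ?y t = ?proj (lam_v t)"
    using optimal_control_is_projection[OF lims oc(2)] by blast
  have "\<forall>\<^sub>F t in at ?\<tau>. ?proj (lam_v t) = accel ?y t"
    using eventually_at_avoid_finite[OF \<open>finite D\<close> assms(4,5)] by eventually_elim (simp add: proj)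
  then have ev: "\<forall>\<^sub>F t in at_left ?\<tau>. ?proj (lam_v t) = accel ?y t"
      "\<forall>\<^sub>F t in at_right ?\<tau>. ?proj (lam_v t) = accel ?y t"
    by (auto simp: eventually_at_split)
  note lam = piecewise_continuous_on_one_sided_limits[OF oc(1) assms(4,5)]
  have "(accel ?y \<longlongrightarrow> ?proj (left_lim lam_v ?\<tau>)) (at_left ?\<tau>)"
    by (rule Lim_transform_eventually[OF _ ev(1)]) (intro tendsto_intros lam)
  moreover have "(accel ?y \<longlongrightarrow> ?proj (right_lim lam_v ?\<tau>)) (at_right ?\<tau>)"
    by (rule Lim_transform_eventually[OF _ ev(2)]) (intro tendsto_intros lam)
  ultimately show ?thesis
    unfolding assms(6) speed_costate_continuous_at_contact[OF oc(3)] by blast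
qed

end
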